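(* Let $G$ be a bipartite graph with parts $A$ and $B$ ($A\ne\emptyset$) which is not complete bipartite, i.e. some vertex of $A$ is non-adjacent to some vertex of $B$. Let $u_B$ be the number of vertices of $B$ adjacent to all vertices of $A$, and let $\delta_A$ be the minimum degree of the vertices in $A$. Then $$\mathrm{box}(G)\ge\frac{|B|-u_B}{2(|B|-\delta_A)}.$$
   Context: The boxicity $\mathrm{box}(G)$ is the minimum $k$ such that there are interval graphs $I_1,\dots,I_k$ on $V(G)$ with $E(G)=E(I_1)\cap\cdots\cap E(I_k)$. *)

theory Defs
  imports Complex_Main
begin

definition all_pairs :: "'a set \<Rightarrow> 'a set set" where
  "all_pairs V = {{u, v} | u v. u \<in> V \<and> v \<in> V \<and> u \<noteq> v}"

definition simple_graph :: "'a set \<Rightarrow> 'a set set \<Rightarrow> bool" where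
  "simple_graph V E \<longleftrightarrow> finite V \<and> E \<subseteq> all_pairs V"

definition bipartite_graph :: "'a set \<Rightarrow> 'a set \<Rightarrow> 'a set set \<Rightarrow> bool" where
  "bipartite_graph A B E \<longleftrightarrow>
     simple_graph (A \<union> B) E \<and> A \<inter> B = {} \<and>
     (\<forall>e\<in>E. \<exists>a\<in>A. \<exists>b\<in>B. e = {a, b})"

definition degree :: "'a set \<Rightarrow> 'a set set \<Rightarrow> 'a \<Rightarrow> nat" where
  "degree V E x = card {v \<in> V. {x, v} \<in> E}"

definition interval_graph :: "'a set \<Rightarrow> 'a set set \<Rightarrow> bool" where
  "interval_graph V E \<longleftrightarrow>
     (\<exists>l r :: 'a \<Rightarrow> real. (\<forall>v\<in>V. l v \<le> r v) \<and>
        E = {{u, v} | u v. u \<in> V \<and> v \<in> V \<and> u \<noteq> v \<and> {l u..r u} \<inter> {l v..r v} \<noteq> {}})"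

text \<open>The intersection is taken inside the edge set of the complete graph on \<open>V\<close>, so that the
  empty intersection (\<open>k = 0\<close>) is the complete graph, which thus has boxicity 0. For a
  finite simple graph some \<open>k\<close> always exists (one interval graph for each non-edge), so the
  \<open>LEAST\<close> below is a genuine minimum.\<close>

definition box_representable :: "'a set \<Rightarrow> 'a set set \<Rightarrow> nat \<Rightarrow> bool" where
  "box_representable V E k \<longleftrightarrow>
     (\<exists>I :: nat \<Rightarrow> 'a set set. (\<forall>i<k. interval_graph V (I i)) \<and>
        E = all_pairs V \<inter> (\<Inter>i<k. I i))"

definition boxicity :: "'a set \<Rightarrow> 'a set set \<Rightarrow> nat" where
  "boxicity V E = (LEAST k. box_representable V E k)"

end

theory Submission
  imports Defs
begin

text \<open>
  In an interval supergraph of \<open>G\<close>, let \<open>p \<in> A\<close> have the smallest right endpoint and \<open>q \<in> A\<close> the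
  largest left endpoint. An interval of \<open>B\<close> disjoint from that of some vertex of \<open>A\<close> lies to its
  right, hence misses \<open>p\<close>, or to its left, hence misses \<open>q\<close>. So at most \<open>2 (|B| - \<delta>\<^sub>A)\<close> vertices
  of \<open>B\<close> have a non-neighbour in \<open>A\<close> in that supergraph, while every non-universal vertex of \<open>B\<close>
  must have one in some graph of the representation.
\<close>

text \<open>Stated for an arbitrary edge set, because it is applied both to \<open>E\<close> and to
  the interval supergraphs, which need not be bipartite.\<close>

definition non_universal :: "'a set \<Rightarrow> 'a set \<Rightarrow> 'a set set \<Rightarrow> 'a set" where
  "non_universal A B E = {b \<in> B. \<exists>a\<in>A. {a, b} \<notin> E}"

lemma finite_all_pairs: "finite V \<Longrightarrow> finite (all_pairs V)"
  by (rule finite_subset[of _ "Pow V"]) (auto simp: all_pairs_def)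

lemma interval_graph_all_pairs_minus_edge:
  assumes "x \<noteq> y"
  shows "interval_graph V (all_pairs V - {{x, y}})"
proof -
  \<comment> \<open>\<open>x\<close> gets the point 0, \<open>y\<close> the point 1 and every other
    vertex all of [0, 1], so only \<open>x\<close> and \<open>y\<close> fail to meet.\<close>
  define l :: "'a \<Rightarrow> real" where "l = (\<lambda>v. if v = y then 1 else 0)"
  define r :: "'a \<Rightarrow> real" where "r = (\<lambda>v. if v = x then 0 else 1)"
  have meet: "{l u..r u} \<inter> {l v..r v} \<noteq> {} \<longleftrightarrow> {u, v} \<noteq> {x, y}" if "u \<noteq> v" for u v
    using that assms by (auto simp: l_def r_def doubleton_eq_iff)
  have "\<forall>v\<in>V. l v \<le> r v"
    using assms by (auto simp: l_def r_def)
  moreover have "all_pairs V - {{x, y}} =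
      {{u, v} | u v. u \<in> V \<and> v \<in> V \<and> u \<noteq> v \<and> {u, v} \<noteq> {x, y}}"
    unfolding all_pairs_def by auto
  then have "all_pairs V - {{x, y}} =
      {{u, v} | u v. u \<in> V \<and> v \<in> V \<and> u \<noteq> v \<and> {l u..r u} \<inter> {l v..r v} \<noteq> {}}"
    using meet by (simp cong: conj_cong)
  ultimately show ?thesis
    unfolding interval_graph_def by (intro exI conjI)
qed

text \<open>\<open>LEAST\<close> yields a representation only once some \<open>k\<close> admits one;
  deleting a single non-edge of the graph from the complete graph, for each non-edge in turn,
  provides it.\<close>

lemma box_representable_boxicity:
  assumes "simple_graph V E"
  shows "box_representable V E (boxicity V E)"
proof -
  define N where "N = all_pairs V - E"
  have "finite N" and E: "E \<subseteq> all_pairs V"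
    using assms finite_all_pairs by (auto simp: simple_graph_def N_def)
  then obtain f where f: "bij_betw f {..<card N} N"
    using ex_bij_betw_nat_finite[of N] by (auto simp: atLeast0LessThan)
  then have fN: "f ` {..<card N} = N"
    by (simp add: bij_betw_def)
  have "interval_graph V (all_pairs V - {f i})" if "i < card N" for i
  proof -
    have "f i \<in> all_pairs V"
      using that fN N_def by blast
    then obtain x y where "f i = {x, y}" "x \<noteq> y"
      by (auto simp: all_pairs_def)
    then show ?thesis
      by (simp add: interval_graph_all_pairs_minus_edge)
  qed
  moreover have "E = all_pairs V \<inter> (\<Inter>i<card N. all_pairs V - {f i})"
  proof -
    have "all_pairs V \<inter> (\<Inter>i<card N. all_pairs V - {f i}) = all_pairs V - f ` {..<card N}"
      by auto
    also have "\<dots> = E"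
      unfolding fN using E by (auto simp: N_def)
    finally show ?thesis ..
  qed
  ultimately have "box_representable V E (card N)"
    unfolding box_representable_def by (intro exI[of _ "\<lambda>i. all_pairs V - {f i}"] conjI) auto
  then show ?thesis
    unfolding boxicity_def by (rule LeastI)
qed

lemma interval_graph_non_universal:
  assumes "interval_graph V I" "finite A" "A \<noteq> {}" "A \<subseteq> V" "B \<subseteq> V" "A \<inter> B = {}"
  obtains p q where "p \<in> A" "q \<in> A"
    "non_universal A B I \<subseteq> {b \<in> B. {p, b} \<notin> I} \<union> {b \<in> B. {q, b} \<notin> I}"
proof -
  obtain l r :: "'a \<Rightarrow> real" where lr: "\<forall>v\<in>V. l v \<le> r v"
    and I: "I = {{u, v} | u v. u \<in> V \<and> v \<in> V \<and> u \<noteq> v \<and> {l u..r u} \<inter> {l v..r v} \<noteq> {}}"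
    using assms(1) unfolding interval_graph_def by blast
  \<comment> \<open>Two nonempty closed intervals are disjoint iff one ends strictly before the
    other begins.\<close>
  have edge: "{a, b} \<notin> I \<longleftrightarrow> r a < l b \<or> r b < l a" if "a \<in> A" "b \<in> B" for a b
  proof -
    have ab: "a \<in> V" "b \<in> V" "a \<noteq> b" "l a \<le> r a" "l b \<le> r b"
      using that assms lr by auto
    have "{a, b} \<in> I \<longleftrightarrow> {l a..r a} \<inter> {l b..r b} \<noteq> {}"
      unfolding I using ab by (auto simp: doubleton_eq_iff Int_commute)
    also have "\<dots> \<longleftrightarrow> l b \<le> r a \<and> l a \<le> r b"
      using ab(4,5) by auto
    finally show ?thesis by auto
  qed
  obtain p where p: "p \<in> A" "\<And>a. a \<in> A \<Longrightarrow> r p \<le> r a"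
    using obtains_MIN[OF assms(2,3), of r] assms(2) by (metis Min_le finite_imageI imageI)
  obtain q where q: "q \<in> A" "\<And>a. a \<in> A \<Longrightarrow> l a \<le> l q"
    using obtains_MAX[OF assms(2,3), of l] assms(2) by (metis Max_ge finite_imageI imageI)
  \<comment> \<open>Either \<open>r p \<le> r a < l b\<close>, or
    \<open>r b < l a \<le> l q\<close>.\<close>
  have "{p, b} \<notin> I \<or> {q, b} \<notin> I" if "b \<in> B" "a \<in> A" "{a, b} \<notin> I" for a b
    using edge[OF p(1) that(1)] edge[OF q(1) that(1)] edge[OF that(2,1)] that(3)
      p(2)[OF that(2)] q(2)[OF that(2)] by linarith
  then show ?thesis
    using p(1) q(1) by (intro that[of p q]) (auto simp: non_universal_def)
qed

text \<open>A union bound over the \<open>k\<close> interval graphs: each accounts for at most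
  \<open>d\<close> vertices through \<open>p\<close> and \<open>d\<close> through
  \<open>q\<close>.\<close>

lemma card_non_universal_le:
  assumes "box_representable V E k" "finite A" "A \<noteq> {}" "A \<subseteq> V" "finite B" "B \<subseteq> V" "A \<inter> B = {}"
    and "\<And>a. a \<in> A \<Longrightarrow> card {b \<in> B. {a, b} \<notin> E} \<le> d"
  shows "card (non_universal A B E) \<le> k * (2 * d)"
proof -
  obtain I where I: "\<forall>i<k. interval_graph V (I i)" and E: "E = all_pairs V \<inter> (\<Inter>i<k. I i)"
    using assms(1) unfolding box_representable_def by blast
  have le: "card (non_universal A B (I i)) \<le> 2 * d" if "i < k" for i
  proof -
    have "interval_graph V (I i)"
      using I that by blast
    then obtain p q where pq: "p \<in> A" "q \<in> A"
      and sub: "non_universal A B (I i) \<subseteq> {b \<in> B. {p, b} \<notin> I i} \<union> {b \<in> B. {q, b} \<notin> I i}"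
      using assms(2-4,6,7) by (rule interval_graph_non_universal)
    \<comment> \<open>Non-neighbours in the supergraph are non-neighbours in \<open>E\<close>, so
      the bound \<open>d\<close> applies to \<open>p\<close> and \<open>q\<close>.\<close>
    have "E \<subseteq> I i"
      using E that by blast
    then have "non_universal A B (I i) \<subseteq> {b \<in> B. {p, b} \<notin> E} \<union> {b \<in> B. {q, b} \<notin> E}"
      using sub by blast
    then have "card (non_universal A B (I i))
        \<le> card ({b \<in> B. {p, b} \<notin> E} \<union> {b \<in> B. {q, b} \<notin> E})"
      using assms(5) by (intro card_mono) auto
    also have "\<dots> \<le> card {b \<in> B. {p, b} \<notin> E} + card {b \<in> B. {q, b} \<notin> E}"
      by (rule card_Un_le)
    finally show ?thesis
      using assms(8)[OF pq(1)] assms(8)[OF pq(2)] by linarith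
  qed
  \<comment> \<open>As \<open>a\<close> and \<open>b\<close> are distinct, a pair missing from
    \<open>E\<close> must be missing from some \<open>I i\<close>.\<close>
  have "{a, b} \<in> all_pairs V" if "a \<in> A" "b \<in> B" for a b
    using that assms(4,6,7) unfolding all_pairs_def by blast
  then have "non_universal A B E \<subseteq> (\<Union>i<k. non_universal A B (I i))"
    unfolding non_universal_def E by blast
  then have "card (non_universal A B E) \<le> card (\<Union>i<k. non_universal A B (I i))"
    using assms(5) by (intro card_mono) (auto simp: non_universal_def)
  also have "\<dots> \<le> (\<Sum>i<k. card (non_universal A B (I i)))"
    by (rule card_UN_le) simp
  also have "\<dots> \<le> (\<Sum>i<k. 2 * d)"
    using le by (intro sum_mono) auto
  finally show ?thesis by simp
qed

text \<open>All neighbours of \<open>a\<close> lie in \<open>B\<close>, so its degree and its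
  non-neighbours in \<open>B\<close> together count \<open>B\<close>. This turns the minimum degree
  into a bound on non-neighbours.\<close>

lemma bipartite_graph_degree:
  assumes "bipartite_graph A B E" "a \<in> A"
  shows "degree (A \<union> B) E a + card {b \<in> B. {a, b} \<notin> E} = card B"
proof -
  have fin: "finite B"
    using assms by (simp add: bipartite_graph_def simple_graph_def)
  have "{v \<in> A \<union> B. {a, v} \<in> E} = {b \<in> B. {a, b} \<in> E}"
    using assms unfolding bipartite_graph_def by (fastforce simp: doubleton_eq_iff)
  then have "degree (A \<union> B) E a + card {b \<in> B. {a, b} \<notin> E}
      = card ({b \<in> B. {a, b} \<in> E} \<union> {b \<in> B. {a, b} \<notin> E})"
    unfolding degree_def using fin by (subst card_Un_disjoint) auto
  also have "{b \<in> B. {a, b} \<in> E} \<union> {b \<in> B. {a, b} \<notin> E} = B"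
    by blast
  finally show ?thesis .
qed

theorem theorem10:
  fixes A B :: "'a set" and E :: "'a set set" and u\<^sub>B \<delta>\<^sub>A :: nat
  assumes "bipartite_graph A B E"
    and "A \<noteq> {}"
    and "\<exists>a\<in>A. \<exists>b\<in>B. {a, b} \<notin> E"
    and "u\<^sub>B = card {b \<in> B. \<forall>a\<in>A. {a, b} \<in> E}"
    and "\<delta>\<^sub>A = Min (degree (A \<union> B) E ` A)"
  shows "real (boxicity (A \<union> B) E) \<ge>
           (real (card B) - real u\<^sub>B) / (2 * (real (card B) - real \<delta>\<^sub>A))"
proof -
  have graph: "simple_graph (A \<union> B) E" and fin: "finite A" "finite B" and disj: "A \<inter> B = {}"
    using assms(1) by (auto simp: bipartite_graph_def simple_graph_def)
  have \<delta>_le: "\<delta>\<^sub>A \<le> degree (A \<union> B) E a" if "a \<in> A" for a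
    using that fin(1) assms(5) by simp
  have nonadj: "card {b \<in> B. {a, b} \<notin> E} \<le> card B - \<delta>\<^sub>A" if "a \<in> A" for a
    using bipartite_graph_degree[OF assms(1) that] \<delta>_le[OF that] by linarith
  \<comment> \<open>The assumed non-adjacent pair makes the denominator positive.\<close>
  have \<delta>_less: "\<delta>\<^sub>A < card B"
  proof -
    obtain a b where ab: "a \<in> A" "b \<in> B" "{a, b} \<notin> E"
      using assms(3) by blast
    then have "card {b \<in> B. {a, b} \<notin> E} > 0"
      using fin(2) by (auto simp: card_gt_0_iff)
    then show ?thesis
      using nonadj[OF ab(1)] by linarith
  qed
  have "non_universal A B E = B - {b \<in> B. \<forall>a\<in>A. {a, b} \<in> E}"
    unfolding non_universal_def by blast
  then have "card (non_universal A B E) = card B - u\<^sub>B"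
    using fin(2) assms(4) by (simp add: card_Diff_subset)
  \<comment> \<open>Moving \<open>u\<^sub>B\<close> to the right avoids truncated subtraction on the
    left; \<open>card B - \<delta>\<^sub>A\<close> is not truncated, by
    \<open>\<delta>_less\<close>.\<close>
  then have "card B \<le> u\<^sub>B + boxicity (A \<union> B) E * (2 * (card B - \<delta>\<^sub>A))"
    using card_non_universal_le[OF box_representable_boxicity[OF graph] fin(1) assms(2) _ fin(2) _
        disj nonadj] by simp
  then have "real (card B)
      \<le> real (u\<^sub>B + boxicity (A \<union> B) E * (2 * (card B - \<delta>\<^sub>A)))"
    by (rule of_nat_mono)
  then have "real (card B) - real u\<^sub>B
      \<le> real (boxicity (A \<union> B) E) * (2 * (real (card B) - real \<delta>\<^sub>A))"
    using \<delta>_less by simp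
  then show ?thesis
    using \<delta>_less by (subst pos_divide_le_eq) auto
qed

end
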